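(* Let $d\in\mathbb N$ and let $X_1,\dots,X_d$ be real-valued random variables on an atomless probability space (no integrability assumed). If a counter-monotonic version $(X_1^{\rm ct},\dots,X_d^{\rm ct})$ of $(X_1,\dots,X_d)$ exists, then $$X_1^{\rm ct}+\cdots+X_d^{\rm ct}\le_{\rm cx} X_1+\cdots+X_d.$$
   Context: An expectation $\mathbb E[V]$ is well-defined if $\mathbb E[\max\{V,0\}]<\infty$ or $\mathbb E[\max\{-V,0\}]<\infty$. We write $U\le_{\rm cx}V$ if $\mathbb E[u(U)]\le\mathbb E[u(V)]$ for all convex $u:\mathbb R\to\mathbb R$ such that both expectations are well-defined. A pair $(X,Y)$ is comonotonic if $X=f(Z)$, $Y=g(Z)$ a.s. for some random variable $Z$ and increasing $f,g$, and counter-monotonic if $(X,-Y)$ is comonotonic. A random vector is counter-monotonic if each pair of its components is counter-monotonic. A counter-monotonic version of $(X_1,\dots,X_d)$ is a counter-monotonic random vector $(X_1',\dots,X_d')$ with $X_i'$ distributed as $X_i$ for each $i$. *)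

theory Defs
  imports "HOL-Probability.Probability"
begin

definition atomless :: "'a measure \<Rightarrow> bool" where
  "atomless M \<longleftrightarrow> (\<forall>A\<in>sets M. measure M A > 0 \<longrightarrow>
      (\<exists>B\<in>sets M. B \<subseteq> A \<and> 0 < measure M B \<and> measure M B < measure M A))"

definition pos_exp :: "'a measure \<Rightarrow> ('a \<Rightarrow> real) \<Rightarrow> ennreal" where
  "pos_exp M V = (\<integral>\<^sup>+ x. ennreal (max (V x) 0) \<partial>M)"

definition neg_exp :: "'a measure \<Rightarrow> ('a \<Rightarrow> real) \<Rightarrow> ennreal" where
  "neg_exp M V = (\<integral>\<^sup>+ x. ennreal (max (- V x) 0) \<partial>M)"

definition exp_well_defined :: "'a measure \<Rightarrow> ('a \<Rightarrow> real) \<Rightarrow> bool" where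
  "exp_well_defined M V \<longleftrightarrow> pos_exp M V < \<infinity> \<or> neg_exp M V < \<infinity>"

definition ext_expectation :: "'a measure \<Rightarrow> ('a \<Rightarrow> real) \<Rightarrow> ereal" where
  "ext_expectation M V = enn2ereal (pos_exp M V) - enn2ereal (neg_exp M V)"

definition cx_le :: "'a measure \<Rightarrow> ('a \<Rightarrow> real) \<Rightarrow> ('a \<Rightarrow> real) \<Rightarrow> bool" where
  "cx_le M U V \<longleftrightarrow> (\<forall>u::real \<Rightarrow> real. convex_on UNIV u \<longrightarrow>
      exp_well_defined M (\<lambda>x. u (U x)) \<longrightarrow> exp_well_defined M (\<lambda>x. u (V x)) \<longrightarrow>
      ext_expectation M (\<lambda>x. u (U x)) \<le> ext_expectation M (\<lambda>x. u (V x)))"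

definition comonotonic :: "'a measure \<Rightarrow> ('a \<Rightarrow> real) \<Rightarrow> ('a \<Rightarrow> real) \<Rightarrow> bool" where
  "comonotonic M X Y \<longleftrightarrow> (\<exists>(Z::'a \<Rightarrow> real) (f::real \<Rightarrow> real) (g::real \<Rightarrow> real).
      Z \<in> borel_measurable M \<and> mono f \<and> mono g \<and>
      (AE x in M. X x = f (Z x) \<and> Y x = g (Z x)))"

definition counter_monotonic :: "'a measure \<Rightarrow> ('a \<Rightarrow> real) \<Rightarrow> ('a \<Rightarrow> real) \<Rightarrow> bool" where
  "counter_monotonic M X Y \<longleftrightarrow> comonotonic M X (\<lambda>x. - Y x)"

definition counter_monotonic_vec :: "'a measure \<Rightarrow> nat \<Rightarrow> (nat \<Rightarrow> 'a \<Rightarrow> real) \<Rightarrow> bool" where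
  "counter_monotonic_vec M d X \<longleftrightarrow>
     (\<forall>i<d. \<forall>j<d. i \<noteq> j \<longrightarrow> counter_monotonic M (X i) (X j))"

end

theory Submission
  imports Defs
begin

text \<open>Only nonnegative convex \<open>u\<close> matter: \<open>max u (-n)\<close> is convex and bounded below, so monotone
  convergence handles the rest and no integrability is needed. On a set of full measure,
  counter-monotonicity is a pointwise condition: when one component increases from one sample point
  to another, no other component increases. Hence two sample points differ in at most two
  components, and if at least three components are nonconstant there is a centre \<open>m\<close> such that (up
  to a global sign) every sample vector is \<open>m + t e\<^sub>i\<close> with \<open>t \<ge> 0\<close>; the claim is then the
  superadditivity of \<open>t \<mapsto> u (c + t) - u c\<close> on the half-line. Otherwise only two components \<open>X, Y\<close>
  matter. Moving the minimum of \<open>u\<close> to \<open>0\<close> makes \<open>u (X + Y)\<close> decrease under clipping, so \<open>X, Y\<close> may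
  be assumed bounded, and \<open>X\<close> may be assumed to take values on a finite grid \<open>p\<^sub>0 \<le> p\<^sub>1 \<le> \<dots>\<close>. Telescoping
  \<open>u (X + Y)\<close> over the grid leaves integrals of the increasing functions
  \<open>\<psi>\<^sub>k Y = u (p\<^sub>k\<^sub>+\<^sub>1 + Y) - u (p\<^sub>k + Y)\<close> over the events \<open>X > p\<^sub>k\<close>; counter-monotonicity places
  these events where \<open>\<psi>\<^sub>k Y\<close> is smallest.\<close>

section \<open>Convex functions on the line\<close>

text \<open>Both \<open>x + h\<close> and \<open>y\<close> are convex combinations of
  \<open>x\<close> and \<open>y + h\<close>, with exchanged weights; adding the two convexity
  inequalities gives the claim.\<close>

lemma convex_increment_mono:
  fixes u :: "real \<Rightarrow> real"
  assumes u: "convex_on UNIV u" and "0 \<le> h" "x \<le> y"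
  shows "u (x + h) - u x \<le> u (y + h) - u y"
proof (cases "y + h - x = 0")
  case True
  with assms have "h = 0" "x = y" by auto
  then show ?thesis by simp
next
  case False
  define L where "L = y + h - x"
  define t where "t = h / L"
  have L: "L > 0" using False assms by (auto simp: L_def)
  have t: "0 \<le> t" "t \<le> 1" using L assms by (auto simp: t_def L_def)
  have tL: "t * L = h" using L by (simp add: t_def)
  have "u ((1 - t) *\<^sub>R x + t *\<^sub>R (y + h)) \<le> (1 - t) * u x + t * u (y + h)"
    using convex_onD[OF u t] by auto
  moreover have "(1 - t) *\<^sub>R x + t *\<^sub>R (y + h) = x + h"
    using tL by (simp add: L_def algebra_simps)
  moreover have "u ((1 - t) *\<^sub>R (y + h) + t *\<^sub>R x) \<le> (1 - t) * u (y + h) + t * u x"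
    using convex_onD[OF u t] by auto
  moreover have "(1 - t) *\<^sub>R (y + h) + t *\<^sub>R x = y"
    using tL by (simp add: L_def algebra_simps)
  ultimately show ?thesis by (simp add: algebra_simps)
qed

text \<open>Induction: the step \<open>x j\<close> gains at least as much at
  \<open>c + sum x I\<close> as at \<open>c\<close>. Sums on both sides instead of differences let
  the inequality pass to nonnegative integrals when \<open>u\<close> is nonnegative.\<close>

lemma convex_superadditive:
  fixes u :: "real \<Rightarrow> real"
  assumes u: "convex_on UNIV u" and "finite I" "\<And>i. i \<in> I \<Longrightarrow> 0 \<le> x i"
  shows "(\<Sum>i\<in>I. u (c + x i)) + u c \<le> u (c + (\<Sum>i\<in>I. x i)) + real (card I) * u c"
  using assms(2,3)
proof (induction I rule: finite_induct)
  case (insert j I)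
  have "u (c + x j) - u c \<le> u (c + sum x I + x j) - u (c + sum x I)"
    using convex_increment_mono[OF u, of "x j" c "c + sum x I"] insert.prems
    by (simp add: sum_nonneg)
  with insert show ?case by (simp add: algebra_simps)
qed simp

lemma convex_on_compose_add:
  fixes u :: "real \<Rightarrow> real"
  assumes "convex_on UNIV u"
  shows "convex_on UNIV (\<lambda>x. u (x + c))"
proof (rule convex_onI)
  fix t x y :: real
  assume "0 < t" "t < 1"
  then have "u ((1 - t) *\<^sub>R (x + c) + t *\<^sub>R (y + c)) \<le> (1 - t) * u (x + c) + t * u (y + c)"
    by (intro convex_onD[OF assms]) auto
  then show "u ((1 - t) *\<^sub>R x + t *\<^sub>R y + c) \<le> (1 - t) * u (x + c) + t * u (y + c)"
    by (simp add: algebra_simps)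
qed simp

lemma convex_on_compose_uminus:
  fixes u :: "real \<Rightarrow> real"
  assumes "convex_on UNIV u"
  shows "convex_on UNIV (\<lambda>x. u (- x))"
proof (rule convex_onI)
  fix t x y :: real
  assume "0 < t" "t < 1"
  then have "u ((1 - t) *\<^sub>R (- x) + t *\<^sub>R (- y)) \<le> (1 - t) * u (- x) + t * u (- y)"
    by (intro convex_onD[OF assms]) auto
  then show "u (- ((1 - t) *\<^sub>R x + t *\<^sub>R y)) \<le> (1 - t) * u (- x) + t * u (- y)"
    by simp
qed simp

text \<open>Used with \<open>b = - c\<close>, which turns any convex \<open>u\<close> into a
  nonnegative convex function.\<close>

lemma convex_on_max_add:
  fixes u :: "real \<Rightarrow> real"
  assumes "convex_on UNIV u"
  shows "convex_on UNIV (\<lambda>x. max (u x) c + b)"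
proof (rule convex_onI)
  fix t x y :: real
  assume t: "0 < t" "t < 1"
  have "u ((1 - t) *\<^sub>R x + t *\<^sub>R y) \<le> (1 - t) * u x + t * u y"
    using t by (intro convex_onD[OF assms]) auto
  also have "\<dots> \<le> (1 - t) * max (u x) c + t * max (u y) c"
    using t by (intro add_mono mult_left_mono) auto
  finally have "u ((1 - t) *\<^sub>R x + t *\<^sub>R y) \<le> (1 - t) * max (u x) c + t * max (u y) c" .
  moreover have "c \<le> (1 - t) * max (u x) c + t * max (u y) c"
  proof -
  have "(1 - t) * c + t * c \<le> (1 - t) * max (u x) c + t * max (u y) c"
    using t by (intro add_mono mult_left_mono) auto
  then show ?thesis
    by (simp add: algebra_simps)
  qed
  ultimately have "max (u ((1 - t) *\<^sub>R x + t *\<^sub>R y)) c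
      \<le> (1 - t) * max (u x) c + t * max (u y) c"
    by (rule max.boundedI)
  then show "max (u ((1 - t) *\<^sub>R x + t *\<^sub>R y)) c + b
      \<le> (1 - t) * (max (u x) c + b) + t * (max (u y) c + b)"
    by (simp add: algebra_simps)
qed simp

lemma convex_real_continuous:
  fixes u :: "real \<Rightarrow> real"
  assumes "convex_on UNIV u"
  shows "continuous_on UNIV u"
  using convex_on_continuous[OF _ assms] by simp

lemma convex_real_measurable:
  fixes u :: "real \<Rightarrow> real"
  assumes "convex_on UNIV u"
  shows "u \<in> borel_measurable borel"
  by (intro borel_measurable_continuous_onI convex_real_continuous assms)

text \<open>Convexity on the segment from the minimizer 0 to \<open>s\<close> even bounds the left
  side by \<open>t * u s\<close>.\<close>

lemma convex_min_at_0_le: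
  fixes u :: "real \<Rightarrow> real"
  assumes u: "convex_on UNIV u" and "u 0 = 0" "\<And>s. 0 \<le> u s"
    and "0 \<le> t" "t \<le> 1"
  shows "u (t * s) \<le> u s"
proof -
  have "u ((1 - t) *\<^sub>R 0 + t *\<^sub>R s) \<le> (1 - t) * u 0 + t * u s"
    using assms by (intro convex_onD[OF u]) auto
  also have "\<dots> \<le> 1 * u s"
    using assms mult_right_mono[of t 1 "u s"] by simp
  finally show ?thesis by simp
qed

section \<open>Truncation to a symmetric interval\<close>

definition clip :: "real \<Rightarrow> real \<Rightarrow> real" where
  "clip N x = max (- N) (min N x)"

text \<open>Clipping is increasing and 1-Lipschitz, so its difference quotients lie in [0, 1]. The
  scaling factor is the form that \<open>convex_min_at_0_le\<close> accepts.\<close>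

lemma clip_diff_scaled:
  "\<exists>t. 0 \<le> t \<and> t \<le> 1 \<and> clip N x - clip N y = t * (x - y)"
proof (cases "x = y")
  case True
  then show ?thesis by (intro exI[of _ 0]) auto
next
  case False
  have "0 \<le> (clip N x - clip N y) / (x - y) \<and> (clip N x - clip N y) / (x - y) \<le> 1"
    using False by (cases "x < y") (auto simp: clip_def divide_simps max_def min_def)
  then show ?thesis using False
    by (intro exI[of _ "(clip N x - clip N y) / (x - y)"]) auto
qed

lemma clip_measurable [measurable]: "clip N \<in> borel_measurable borel"
  unfolding clip_def by measurable

lemma clip_mono: "x \<le> y \<Longrightarrow> clip N x \<le> clip N y"
  by (auto simp: clip_def)

lemma abs_clip_le: "0 \<le> N \<Longrightarrow> \<bar>clip N x\<bar> \<le> N"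
  by (auto simp: clip_def)

lemma clip_eventually: "eventually (\<lambda>n. clip (real n) x = x) sequentially"
proof -
  obtain k where "\<bar>x\<bar> \<le> real k" using real_arch_simple by blast
  then show ?thesis
    by (intro eventually_sequentiallyI[of k]) (auto simp: clip_def)
qed

section \<open>Reduction of the convex order to nonnegative convex functions\<close>

lemma cx_leI:
  fixes U V :: "'a \<Rightarrow> real"
  assumes [measurable]: "U \<in> borel_measurable M" "V \<in> borel_measurable M"
    and "prob_space M"
    and le: "\<And>u. convex_on UNIV u \<Longrightarrow> (\<And>s. 0 \<le> u s) \<Longrightarrow>
      (\<integral>\<^sup>+x. ennreal (u (U x)) \<partial>M) \<le> (\<integral>\<^sup>+x. ennreal (u (V x)) \<partial>M)"
  shows "cx_le M U V"
  unfolding cx_le_def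
proof (intro allI impI)
  interpret prob_space M by fact
  fix u :: "real \<Rightarrow> real"
  assume u: "convex_on UNIV u"
    and wd: "exp_well_defined M (\<lambda>x. u (U x))" "exp_well_defined M (\<lambda>x. u (V x))"
  note [measurable] = convex_real_measurable[OF u]
  define p where "p Y = pos_exp M (\<lambda>x. u (Y x))" for Y
  define q where "q Y = neg_exp M (\<lambda>x. u (Y x))" for Y
  show "ext_expectation M (\<lambda>x. u (U x)) \<le> ext_expectation M (\<lambda>x. u (V x))"
  proof (cases "p V = \<infinity>")
    case True
    then have "q V < \<infinity>" using wd by (auto simp: exp_well_defined_def p_def q_def)
    then have "ext_expectation M (\<lambda>x. u (V x)) = \<infinity>"
      using True unfolding ext_expectation_def p_def q_def
      by (cases "neg_exp M (\<lambda>x. u (V x))") (auto simp: enn2ereal_ennreal)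
    then show ?thesis by simp
  next
    case False
    have pos: "p U \<le> p V"
      using le[OF convex_on_max_add[OF u, of 0 0]] by (simp add: p_def pos_exp_def)
    define N where "N Y n = (\<integral>\<^sup>+x. ennreal (min (max (- u (Y x)) 0) (real n)) \<partial>M)" for Y n
    define A where "A Y n = (\<integral>\<^sup>+x. ennreal (max (u (Y x)) (- real n) + real n) \<partial>M)" for Y n
    \<comment> \<open>Pointwise, max(u, -n) + n plus the negative part of u capped at n equals the
      positive part plus n. Stated additively, this avoids subtraction in
      \<open>ennreal\<close>.\<close>
    have AN: "A Y n + N Y n = p Y + of_nat n" if [measurable]: "Y \<in> borel_measurable M" for Y n
    proof -
      have "A Y n + N Y n = (\<integral>\<^sup>+x. ennreal (max (u (Y x)) (- real n) + real n)
          + ennreal (min (max (- u (Y x)) 0) (real n)) \<partial>M)"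
        unfolding A_def N_def by (subst nn_integral_add) auto
      also have "\<dots> = (\<integral>\<^sup>+x. ennreal (max (u (Y x)) 0) + ennreal (real n) \<partial>M)"
        by (intro nn_integral_cong)
          (auto simp: ennreal_plus[symmetric] max_def min_def simp del: ennreal_plus)
      also have "\<dots> = p Y + of_nat n"
        unfolding p_def pos_exp_def
        by (subst nn_integral_add) (auto simp: emeasure_space_1 ennreal_of_nat_eq_real_of_nat)
      finally show ?thesis .
    qed
    have NS: "(SUP n. N Y n) = q Y" if [measurable]: "Y \<in> borel_measurable M" for Y
    proof -
      have "(SUP n. N Y n)
          = (\<integral>\<^sup>+x. (SUP n. ennreal (min (max (- u (Y x)) 0) (real n))) \<partial>M)"
        unfolding N_def
        by (subst nn_integral_monotone_convergence_SUP)
          (auto simp: incseq_def le_fun_def intro!: ennreal_leI)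
      also have "\<dots> = q Y"
        unfolding q_def neg_exp_def
      proof (intro nn_integral_cong antisym SUP_least)
        fix x
        obtain k where "max (- u (Y x)) 0 \<le> real k" using real_arch_simple by blast
        then have "ennreal (max (- u (Y x)) 0) \<le> ennreal (min (max (- u (Y x)) 0) (real k))"
          by (intro ennreal_leI) simp
        then show "ennreal (max (- u (Y x)) 0)
            \<le> (SUP n. ennreal (min (max (- u (Y x)) 0) (real n)))"
          by (rule SUP_upper2[OF UNIV_I])
      qed (rule ennreal_leI min.cobounded1)+
      finally show ?thesis .
    qed
    \<comment> \<open>The hypothesis gives \<open>A U n \<le> A V n\<close>. Adding both capped
      negative parts and cancelling the finite \<open>n\<close> leaves this bound; its supremum over
      \<open>n\<close> replaces \<open>N V n\<close> by \<open>q V\<close>.\<close>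
    have "p U + N V n \<le> p V + q U" for n
    proof -
      have "of_nat n + (p U + N V n) = A U n + N U n + N V n"
        by (subst AN) (auto simp: ac_simps)
      also have "\<dots> \<le> A V n + N V n + N U n"
        using le[OF convex_on_max_add[OF u, of "- real n" "real n"]]
        by (auto simp: A_def ac_simps intro!: add_left_mono)
      also have "\<dots> = of_nat n + (p V + N U n)"
        by (subst AN) (auto simp: ac_simps)
      also have "\<dots> \<le> of_nat n + (p V + q U)"
        by (intro add_left_mono) (auto simp flip: NS intro!: SUP_upper)
      finally show ?thesis
        by (simp add: ennreal_add_left_cancel_le)
    qed
    then have "(SUP n. p U + N V n) \<le> p V + q U" by (rule SUP_least)
    then have sum: "p U + q V \<le> p V + q U"
      by (subst (asm) ennreal_SUP_add_right[symmetric]) (auto simp: NS)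
    \<comment> \<open>Here \<open>p V\<close> and hence \<open>p U\<close> are finite, so the sums
      may be rearranged into differences; if \<open>q V\<close> is infinite, so is
      \<open>q U\<close>.\<close>
    have "enn2ereal (p U) - enn2ereal (q U) \<le> enn2ereal (p V) - enn2ereal (q V)"
      using sum False pos
      by (cases "p U"; cases "p V"; cases "q U"; cases "q V")
        (auto simp: enn2ereal_ennreal top_unique ennreal_plus[symmetric] simp del: ennreal_plus)
    then show ?thesis by (simp add: ext_expectation_def p_def q_def)
  qed
qed

section \<open>Random variables with equal distributions\<close>

lemma nn_integral_eq_distr:
  fixes X Y :: "'a \<Rightarrow> real"
  assumes [measurable]: "X \<in> borel_measurable M" "Y \<in> borel_measurable M" "h \<in> borel_measurable borel"
    and "distr M borel X = distr M borel Y"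
  shows "(\<integral>\<^sup>+x. h (X x) \<partial>M) = (\<integral>\<^sup>+x. h (Y x) \<partial>M)"
proof -
  have "(\<integral>\<^sup>+x. h (X x) \<partial>M) = (\<integral>\<^sup>+x. h x \<partial>distr M borel X)"
    by (subst nn_integral_distr) auto
  also have "\<dots> = (\<integral>\<^sup>+x. h (Y x) \<partial>M)"
    unfolding assms(4) by (subst nn_integral_distr) auto
  finally show ?thesis .
qed

lemma integral_eq_distr:
  fixes X Y h :: "_ \<Rightarrow> real"
  assumes [measurable]: "X \<in> borel_measurable M" "Y \<in> borel_measurable M" "h \<in> borel_measurable borel"
    and "distr M borel X = distr M borel Y"
  shows "(\<integral>x. h (X x) \<partial>M) = (\<integral>x. h (Y x) \<partial>M)"
proof -
  have "(\<integral>x. h (X x) \<partial>M) = (\<integral>x. h x \<partial>distr M borel X)"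
    by (subst integral_distr) auto
  also have "\<dots> = (\<integral>x. h (Y x) \<partial>M)"
    unfolding assms(4) by (subst integral_distr) auto
  finally show ?thesis .
qed

lemma AE_eq_distr:
  fixes X Y :: "'a \<Rightarrow> real"
  assumes [measurable]: "X \<in> borel_measurable M" "Y \<in> borel_measurable M" "Measurable.pred borel P"
    and "distr M borel X = distr M borel Y" and "AE x in M. P (X x)"
  shows "AE x in M. P (Y x)"
proof -
  have "AE x in distr M borel X. P x"
    using assms(5) by (subst AE_distr_iff) auto
  then show ?thesis
    unfolding assms(4) by (subst (asm) AE_distr_iff) auto
qed

lemma distr_eq_compose:
  fixes X Y h :: "_ \<Rightarrow> real"
  assumes [measurable]: "X \<in> borel_measurable M" "Y \<in> borel_measurable M" "h \<in> borel_measurable borel"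
    and "distr M borel X = distr M borel Y"
  shows "distr M borel (\<lambda>x. h (X x)) = distr M borel (\<lambda>x. h (Y x))"
proof -
  have "distr M borel (\<lambda>x. h (X x)) = distr (distr M borel X) borel h"
    by (subst distr_distr) (auto simp: comp_def)
  also have "\<dots> = distr M borel (\<lambda>x. h (Y x))"
    unfolding assms(4) by (subst distr_distr) (auto simp: comp_def)
  finally show ?thesis .
qed

section \<open>Mutually exclusive variables\<close>

text \<open>For \<open>Y\<close>, at most one component leaves its minimum, so
  \<open>convex_superadditive\<close> with base point \<open>c\<close> is an equality almost surely;
  for \<open>X\<close> it is an inequality. Its left side is a sum of functions of single components
  and so has the same integral for both.\<close>

lemma (in prob_space) exclusive_sum_le:
  fixes X Y :: "nat \<Rightarrow> 'a \<Rightarrow> real"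
  assumes X [measurable]: "\<And>i. i < d \<Longrightarrow> X i \<in> borel_measurable M"
    and Y [measurable]: "\<And>i. i < d \<Longrightarrow> Y i \<in> borel_measurable M"
    and D: "\<And>i. i < d \<Longrightarrow> distr M borel (Y i) = distr M borel (X i)"
    and lower: "AE x in M. \<forall>i<d. m i \<le> Y i x"
    and excl: "AE x in M. \<forall>i<d. \<forall>j<d. i \<noteq> j \<longrightarrow> Y i x = m i \<or> Y j x = m j"
    and u: "convex_on UNIV u" and u0: "\<And>s. 0 \<le> u s"
  shows "(\<integral>\<^sup>+x. ennreal (u (\<Sum>i<d. Y i x)) \<partial>M) \<le> (\<integral>\<^sup>+x. ennreal (u (\<Sum>i<d. X i x)) \<partial>M)"
proof -
  note [measurable] = convex_real_measurable[OF u]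
  define c where "c = (\<Sum>i<d. m i)"
  have lowerX: "AE x in M. \<forall>i<d. m i \<le> X i x"
  proof -
    have "AE x in M. m i \<le> X i x" if "i < d" for i
    proof -
      have "AE x in M. m i \<le> Y i x" using lower by eventually_elim (use that in auto)
      then show ?thesis
        using AE_eq_distr[OF Y X _ D, where P = "\<lambda>y. m i \<le> y"] that by auto
    qed
    then have "AE x in M. \<forall>i\<in>{..<d}. m i \<le> X i x"
      by (intro AE_finite_allI) auto
    then show ?thesis by (rule eventually_mono) simp
  qed
  have sum_eq: "(\<integral>\<^sup>+x. ennreal ((\<Sum>i<d. u (c + (Z i x - m i))) + u c) \<partial>M)
      = (\<Sum>i<d. \<integral>\<^sup>+x. ennreal (u (c + (Z i x - m i))) \<partial>M) + ennreal (u c)"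
    if [measurable]: "\<And>i. i < d \<Longrightarrow> Z i \<in> borel_measurable M" for Z
  proof -
    have "(\<integral>\<^sup>+x. ennreal ((\<Sum>i<d. u (c + (Z i x - m i))) + u c) \<partial>M)
        = (\<integral>\<^sup>+x. (\<Sum>i<d. ennreal (u (c + (Z i x - m i)))) + ennreal (u c) \<partial>M)"
      using u0 by (simp add: sum_nonneg)
    also have "\<dots> = (\<integral>\<^sup>+x. (\<Sum>i<d. ennreal (u (c + (Z i x - m i)))) \<partial>M) + ennreal (u c)"
      by (subst nn_integral_add) (auto simp del: sum_ennreal simp: emeasure_space_1)
    also have "(\<integral>\<^sup>+x. (\<Sum>i<d. ennreal (u (c + (Z i x - m i)))) \<partial>M)
        = (\<Sum>i<d. \<integral>\<^sup>+x. ennreal (u (c + (Z i x - m i))) \<partial>M)"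
      by (rule nn_integral_sum) auto
    finally show ?thesis .
  qed
  have const_eq: "(\<integral>\<^sup>+x. ennreal (u (\<Sum>i<d. Z i x) + real d * u c) \<partial>M)
      = (\<integral>\<^sup>+x. ennreal (u (\<Sum>i<d. Z i x)) \<partial>M) + ennreal (real d * u c)"
    if [measurable]: "\<And>i. i < d \<Longrightarrow> Z i \<in> borel_measurable M" for Z
    using u0 by (simp add: nn_integral_add emeasure_space_1)
  have centre: "(\<Sum>i<d. Z i x) = c + (\<Sum>i<d. Z i x - m i)" for Z and x :: 'a
    by (simp add: c_def sum_subtractf)
  have "(\<integral>\<^sup>+x. ennreal (u (\<Sum>i<d. Y i x) + real d * u c) \<partial>M)
      = (\<integral>\<^sup>+x. ennreal ((\<Sum>i<d. u (c + (Y i x - m i))) + u c) \<partial>M)"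
  proof (rule nn_integral_cong_AE, use excl in eventually_elim)
    fix x assume x: "\<forall>i<d. \<forall>j<d. i \<noteq> j \<longrightarrow> Y i x = m i \<or> Y j x = m j"
    have "u (c + (\<Sum>i<d. Y i x - m i)) + real d * u c = (\<Sum>i<d. u (c + (Y i x - m i))) + u c"
    proof (cases "\<exists>j<d. Y j x \<noteq> m j")
      case True
      then obtain j where j: "j < d" "Y j x \<noteq> m j" by auto
      with x have z: "Y i x = m i" if "i \<in> {..<d} - {j}" for i using that by auto
      have sum1: "(\<Sum>i<d. Y i x - m i) = Y j x - m j"
        using j z by (subst sum.remove[of _ j]) auto
      \<comment> \<open>The other \<open>d - 1\<close> components sit at their minimum and
        contribute \<open>u c\<close> each.\<close>
      have sum2: "(\<Sum>i<d. u (c + (Y i x - m i))) = u (c + (Y j x - m j)) + (real d - 1) * u c"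
        using j z by (subst sum.remove[of _ j]) (auto simp: of_nat_diff)
      show ?thesis unfolding sum1 sum2 by (simp add: algebra_simps)
    qed simp
    then show "ennreal (u (\<Sum>i<d. Y i x) + real d * u c)
        = ennreal ((\<Sum>i<d. u (c + (Y i x - m i))) + u c)"
      using centre[of Y x] by simp
  qed
  also have "\<dots> = (\<Sum>i<d. \<integral>\<^sup>+x. ennreal (u (c + (Y i x - m i))) \<partial>M) + ennreal (u c)"
    by (rule sum_eq[OF Y])
  also have "\<dots> = (\<Sum>i<d. \<integral>\<^sup>+x. ennreal (u (c + (X i x - m i))) \<partial>M) + ennreal (u c)"
    by (intro arg_cong2[where f = "(+)"] sum.cong refl
        nn_integral_eq_distr[where h = "\<lambda>y. ennreal (u (c + (y - m _)))"]) (auto simp: D)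
  also have "\<dots> = (\<integral>\<^sup>+x. ennreal ((\<Sum>i<d. u (c + (X i x - m i))) + u c) \<partial>M)"
    by (rule sum_eq[OF X, symmetric])
  also have "\<dots> \<le> (\<integral>\<^sup>+x. ennreal (u (\<Sum>i<d. X i x) + real d * u c) \<partial>M)"
  proof (rule nn_integral_mono_AE, use lowerX in eventually_elim)
    fix x assume "\<forall>i<d. m i \<le> X i x"
    then have "(\<Sum>i<d. u (c + (X i x - m i))) + u c
        \<le> u (c + (\<Sum>i<d. X i x - m i)) + real (card {..<d}) * u c"
      by (intro convex_superadditive[OF u]) auto
    then show "ennreal ((\<Sum>i<d. u (c + (X i x - m i))) + u c)
        \<le> ennreal (u (\<Sum>i<d. X i x) + real d * u c)"
      using centre[of X x] by (intro ennreal_leI) simp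
  qed
  also have "\<dots> = (\<integral>\<^sup>+x. ennreal (u (\<Sum>i<d. X i x)) \<partial>M) + ennreal (real d * u c)"
    by (rule const_eq[OF X])
  also have "(\<integral>\<^sup>+x. ennreal (u (\<Sum>i<d. Y i x) + real d * u c) \<partial>M)
      = (\<integral>\<^sup>+x. ennreal (u (\<Sum>i<d. Y i x)) \<partial>M) + ennreal (real d * u c)"
    by (rule const_eq[OF Y])
  finally show ?thesis
    by (simp add: add.commute[of _ "ennreal _"] ennreal_add_left_cancel_le)
qed

section \<open>Counter-monotonic pairs\<close>

text \<open>Pointwise counter-monotonicity without the latent variable; by contraposition it is
  symmetric in \<open>X\<close> and \<open>Y\<close>.\<close>

definition opposed_on :: "'a set \<Rightarrow> ('a \<Rightarrow> real) \<Rightarrow> ('a \<Rightarrow> real) \<Rightarrow> bool" where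
  "opposed_on S X Y \<longleftrightarrow> (\<forall>x\<in>S. \<forall>y\<in>S. X x < X y \<longrightarrow> Y y \<le> Y x)"

lemma opposed_onD: "opposed_on S X Y \<Longrightarrow> x \<in> S \<Longrightarrow> y \<in> S \<Longrightarrow> X x < X y \<Longrightarrow> Y y \<le> Y x"
  by (simp add: opposed_on_def)

lemma counter_monotonic_imp_opposed_on:
  assumes "counter_monotonic M X Y"
  shows "\<exists>S. (AE x in M. x \<in> S) \<and> opposed_on S X Y"
proof -
  obtain Z f g :: "_ \<Rightarrow> real" where fg: "mono f" "mono g"
    and ae: "AE x in M. X x = f (Z x) \<and> - Y x = g (Z x)"
    using assms unfolding counter_monotonic_def comonotonic_def by blast
  have "opposed_on {x. X x = f (Z x) \<and> - Y x = g (Z x)} X Y"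
    unfolding opposed_on_def
  proof (intro ballI impI)
    fix x y
    assume "x \<in> {x. X x = f (Z x) \<and> - Y x = g (Z x)}" "y \<in> {x. X x = f (Z x) \<and> - Y x = g (Z x)}"
      and "X x < X y"
    then have *: "f (Z x) < f (Z y)" "- Y x = g (Z x)" "- Y y = g (Z y)" by auto
    then have "Z x \<le> Z y" using monoD[OF fg(1), of "Z y" "Z x"] by force
    then have "g (Z x) \<le> g (Z y)" by (rule monoD[OF fg(2)])
    with * show "Y y \<le> Y x" by simp
  qed
  with ae show ?thesis by (intro exI conjI) auto
qed

text \<open>Given the marginals, \<open>P(A)\<close> and the law of \<open>\<phi>\<close>, the integral of \<open>\<phi>\<close> over \<open>A\<close> is
  minimal when \<open>A\<close> is a sublevel set of \<open>\<phi>\<close>, because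
  \<open>1\<^sub>A \<phi> \<ge> c 1\<^sub>A + min (\<phi> - c) 0\<close>, with equality when \<open>\<phi> \<le> c\<close> on \<open>A\<close> and \<open>\<phi> \<ge> c\<close> off \<open>A\<close>.\<close>

lemma (in prob_space) sublevel_integral_le:
  fixes \<phi> \<phi>' :: "'a \<Rightarrow> real"
  assumes [measurable]: "A \<in> events" "A' \<in> events" and P: "prob A = prob A'"
    and i: "integrable M \<phi>" "integrable M \<phi>'"
    and D: "distr M borel \<phi> = distr M borel \<phi>'"
    and c: "AE x in M. (x \<in> A \<longrightarrow> \<phi> x \<le> c) \<and> (x \<notin> A \<longrightarrow> c \<le> \<phi> x)"
  shows "(\<integral>x. indicator A x * \<phi> x \<partial>M) \<le> (\<integral>x. indicator A' x * \<phi>' x \<partial>M)"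
proof -
  have [measurable]: "\<phi> \<in> borel_measurable M" "\<phi>' \<in> borel_measurable M"
    using i by auto
  have im: "integrable M (\<lambda>x. min (\<psi> x - c) 0)" if "integrable M \<psi>" for \<psi> :: "'a \<Rightarrow> real"
    using that by (intro integrable_min) auto
  have split: "(\<integral>x. c * indicator B x + min (\<psi> x - c) 0 \<partial>M) = c * prob B + (\<integral>x. min (\<psi> x - c) 0 \<partial>M)"
    if [measurable]: "B \<in> events" and "integrable M \<psi>" for B and \<psi> :: "'a \<Rightarrow> real"
    using im[OF that(2)] by (subst Bochner_Integration.integral_add) (auto simp: less_top[symmetric])
  have "(\<integral>x. indicator A x * \<phi> x \<partial>M) = (\<integral>x. c * indicator A x + min (\<phi> x - c) 0 \<partial>M)"
  proof (rule integral_cong_AE)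
    show "AE x in M. indicator A x * \<phi> x = c * indicator A x + min (\<phi> x - c) 0"
      using c by eventually_elim (auto split: split_indicator)
  qed auto
  also have "\<dots> = c * prob A + (\<integral>x. min (\<phi> x - c) 0 \<partial>M)"
    using i by (intro split) auto
  also have "\<dots> = c * prob A' + (\<integral>x. min (\<phi>' x - c) 0 \<partial>M)"
    unfolding P by (subst integral_eq_distr[where h = "\<lambda>y. min (y - c) 0", OF _ _ _ D]) auto
  also have "\<dots> = (\<integral>x. c * indicator A' x + min (\<phi>' x - c) 0 \<partial>M)"
    using i by (intro split[symmetric]) auto
  also have "\<dots> \<le> (\<integral>x. indicator A' x * \<phi>' x \<partial>M)"
    using i im
    by (intro integral_mono Bochner_Integration.integrable_add integrable_mult_right integrable_mult_indicator[of A' M \<phi>', simplified])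
      (auto split: split_indicator simp: less_top[symmetric] min_def)
  finally show ?thesis .
qed

text \<open>\<open>p (K (X x))\<close> is a grid-valued rounding of \<open>X\<close>. After
  telescoping, the joint law enters only through the integrals of \<open>\<psi> k (Y x)\<close> over
  the events \<open>k < K (X x)\<close>, and \<open>sublevel_integral_le\<close> compares these one
  \<open>k\<close> at a time. Bounded \<open>Y\<close> keeps every term integrable.\<close>

lemma (in prob_space) opposed_grid_le:
  fixes X X' Y Y' :: "'a \<Rightarrow> real" and K :: "real \<Rightarrow> nat" and p :: "nat \<Rightarrow> real"
  assumes [measurable]: "X \<in> borel_measurable M" "X' \<in> borel_measurable M"
      "Y \<in> borel_measurable M" "Y' \<in> borel_measurable M" "K \<in> measurable borel (count_space UNIV)"
    and DX: "distr M borel X = distr M borel X'" and DY: "distr M borel Y = distr M borel Y'"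
    and S: "AE x in M. x \<in> S" "opposed_on S X Y"
    and bound: "\<And>x. \<bar>Y x\<bar> \<le> N" "\<And>x. \<bar>Y' x\<bar> \<le> N"
    and K: "mono K" "\<And>x. K x \<le> n" and p: "mono p"
    and u: "convex_on UNIV u"
  shows "(\<integral>x. u (p (K (X x)) + Y x) \<partial>M) \<le> (\<integral>x. u (p (K (X' x)) + Y' x) \<partial>M)"
proof -
  note [measurable] = convex_real_measurable[OF u]
  define \<psi> where "\<psi> k y = u (p (Suc k) + y) - u (p k + y)" for k y
  have \<psi>_mono: "\<psi> k y \<le> \<psi> k y'" if "y \<le> y'" for k y y'
    using convex_increment_mono[OF u, of "p (Suc k) - p k" "p k + y" "p k + y'"] that
      monoD[OF p, of k "Suc k"]
    by (simp add: \<psi>_def algebra_simps)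
  have [measurable]: "\<psi> k \<in> borel_measurable borel" for k
    unfolding \<psi>_def by measurable
  have int_u: "integrable M (\<lambda>x. u (a + Z x))"
    if [measurable]: "Z \<in> borel_measurable M" and Z: "\<And>x. \<bar>Z x\<bar> \<le> N" for a and Z :: "'a \<Rightarrow> real"
  proof -
    have "bounded (u ` {a - N..a + N})"
      by (intro compact_imp_bounded compact_continuous_image
          continuous_on_subset[OF convex_real_continuous[OF u]]) auto
    then obtain B where B: "\<And>s. s \<in> {a - N..a + N} \<Longrightarrow> \<bar>u s\<bar> \<le> B"
      unfolding bounded_iff by (metis imageI real_norm_def)
    have "\<bar>u (a + Z x)\<bar> \<le> B" for x
      using Z[of x] by (intro B) auto
    then show ?thesis
      by (intro integrable_const_bound[of _ B]) auto
  qed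
  have int_\<psi>: "integrable M (\<lambda>x. \<psi> k (Z x))"
    if "Z \<in> borel_measurable M" "\<And>x. \<bar>Z x\<bar> \<le> N" for k and Z :: "'a \<Rightarrow> real"
    unfolding \<psi>_def using that by (intro Bochner_Integration.integrable_diff int_u)
  \<comment> \<open>The factor \<open>of_bool\<close> fixes the summation range, so that
    \<open>j\<close> may later depend on the sample point.\<close>
  have telescope: "u (p j + y) = u (p 0 + y) + (\<Sum>k<n. of_bool (k < j) * \<psi> k y)" if "j \<le> n" for j y
  proof -
    have "(\<Sum>k<n. of_bool (k < j) * \<psi> k y) = (\<Sum>k<j. \<psi> k y)"
      using that by (intro sum.mono_neutral_cong_right) auto
    also have "\<dots> = u (p j + y) - u (p 0 + y)"
      unfolding \<psi>_def by (rule sum_lessThan_telescope[where f = "\<lambda>k. u (p k + y)"])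
    finally show ?thesis by simp
  qed
  have expand: "(\<integral>x. u (p (K (V x)) + Z x) \<partial>M) = (\<integral>x. u (p 0 + Z x) \<partial>M)
      + (\<Sum>k<n. \<integral>x. indicator {x \<in> space M. k < K (V x)} x * \<psi> k (Z x) \<partial>M)"
    if [measurable]: "V \<in> borel_measurable M" "Z \<in> borel_measurable M" and Z: "\<And>x. \<bar>Z x\<bar> \<le> N"
    for V Z :: "'a \<Rightarrow> real"
  proof -
    have int: "integrable M (\<lambda>x. indicator {x \<in> space M. k < K (V x)} x * \<psi> k (Z x))" for k
      using integrable_mult_indicator[OF _ int_\<psi>[OF that(2) Z], of "{x \<in> space M. k < K (V x)}" k]
      by simp
    have "(\<integral>x. u (p (K (V x)) + Z x) \<partial>M) = (\<integral>x. u (p 0 + Z x)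
        + (\<Sum>k<n. indicator {x \<in> space M. k < K (V x)} x * \<psi> k (Z x)) \<partial>M)"
      by (intro Bochner_Integration.integral_cong refl)
        (subst telescope[OF K(2)], auto intro!: sum.cong)
    also have "\<dots> = (\<integral>x. u (p 0 + Z x) \<partial>M)
        + (\<Sum>k<n. \<integral>x. indicator {x \<in> space M. k < K (V x)} x * \<psi> k (Z x) \<partial>M)"
      by (subst Bochner_Integration.integral_add Bochner_Integration.integral_sum,
          (intro int int_u Bochner_Integration.integrable_sum that)+)+ (rule refl)
    finally show ?thesis .
  qed
  have "(\<integral>x. indicator {x \<in> space M. k < K (X x)} x * \<psi> k (Y x) \<partial>M)
      \<le> (\<integral>x. indicator {x \<in> space M. k < K (X' x)} x * \<psi> k (Y' x) \<partial>M)" for k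
  proof -
    define A where "A = {x \<in> space M. k < K (X x)}"
    \<comment> \<open>\<open>Sup T\<close> is the threshold separating \<open>A\<close> from its
      complement. The inserted value lies below every \<open>\<psi> k (Y x)\<close> and keeps
      \<open>T\<close> nonempty when \<open>A \<inter> S\<close> is empty.\<close>
    define T where "T = insert (\<psi> k (- N)) ((\<lambda>x. \<psi> k (Y x)) ` (A \<inter> S))"
    have YN: "- N \<le> Y x" "Y x \<le> N" for x using bound(1)[of x] by auto
    have sep: "Y x \<le> Y y" if "x \<in> A \<inter> S" "y \<in> S - A" "y \<in> space M" for x y
    proof -
      have "K (X y) < K (X x)" using that by (auto simp: A_def)
      then have "X y < X x" using monoD[OF K(1), of "X x" "X y"] by force
      then show ?thesis using opposed_onD[OF S(2), of y x] that by auto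
    qed
    have bdd: "bdd_above T"
      using YN unfolding T_def by (intro bdd_aboveI[of _ "\<psi> k N"]) (auto intro!: \<psi>_mono order_trans[OF YN(1) YN(2)])
    have "prob {x \<in> space M. k < K (X x)} = prob {x \<in> space M. k < K (X' x)}"
    proof -
      have "prob {x \<in> space M. k < K (Z x)} = measure (distr M borel Z) {y. k < K y}"
        if [measurable]: "Z \<in> borel_measurable M" for Z
        by (subst measure_distr) (auto intro!: arg_cong[where f = prob])
      then show ?thesis using DX by simp
    qed
    moreover have "distr M borel (\<lambda>x. \<psi> k (Y x)) = distr M borel (\<lambda>x. \<psi> k (Y' x))"
      by (rule distr_eq_compose[OF _ _ _ DY]) auto
    moreover have "AE x in M. (x \<in> A \<longrightarrow> \<psi> k (Y x) \<le> Sup T) \<and> (x \<notin> A \<longrightarrow> Sup T \<le> \<psi> k (Y x))"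
      using S(1) AE_space
    proof eventually_elim
      fix x assume x: "x \<in> S" "x \<in> space M"
      show "(x \<in> A \<longrightarrow> \<psi> k (Y x) \<le> Sup T) \<and> (x \<notin> A \<longrightarrow> Sup T \<le> \<psi> k (Y x))"
      proof (intro conjI impI)
        assume "x \<in> A"
        with x show "\<psi> k (Y x) \<le> Sup T" by (intro cSup_upper bdd) (auto simp: T_def)
      next
        assume "x \<notin> A"
        with x show "Sup T \<le> \<psi> k (Y x)"
          by (intro cSup_least) (auto simp: T_def intro!: \<psi>_mono YN sep)
      qed
    qed
    ultimately show ?thesis
      unfolding A_def using bound by (intro sublevel_integral_le int_\<psi>) auto
  qed
  then have "(\<Sum>k<n. \<integral>x. indicator {x \<in> space M. k < K (X x)} x * \<psi> k (Y x) \<partial>M)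
      \<le> (\<Sum>k<n. \<integral>x. indicator {x \<in> space M. k < K (X' x)} x * \<psi> k (Y' x) \<partial>M)"
    by (rule sum_mono)
  moreover have "(\<integral>x. u (p 0 + Y x) \<partial>M) = (\<integral>x. u (p 0 + Y' x) \<partial>M)"
    by (rule integral_eq_distr[OF _ _ _ DY, where h = "\<lambda>y. u (p 0 + y)"]) auto
  ultimately show ?thesis
    using bound by (simp add: expand)
qed

text \<open>Rounding \<open>X\<close> down to grids of mesh 1/(m+1) reduces to
  \<open>opposed_grid_le\<close>; continuity of \<open>u\<close> and dominated convergence pass to
  the limit.\<close>

lemma (in prob_space) opposed_bounded_le:
  fixes X X' Y Y' :: "'a \<Rightarrow> real"
  assumes [measurable]: "X \<in> borel_measurable M" "X' \<in> borel_measurable M"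
      "Y \<in> borel_measurable M" "Y' \<in> borel_measurable M"
    and DX: "distr M borel X = distr M borel X'" and DY: "distr M borel Y = distr M borel Y'"
    and S: "AE x in M. x \<in> S" "opposed_on S X Y"
    and boundX: "\<And>x. \<bar>X x\<bar> \<le> N" "\<And>x. \<bar>X' x\<bar> \<le> N"
    and boundY: "\<And>x. \<bar>Y x\<bar> \<le> N" "\<And>x. \<bar>Y' x\<bar> \<le> N"
    and u: "convex_on UNIV u" and u0: "\<And>s. 0 \<le> u s"
  shows "(\<integral>\<^sup>+x. ennreal (u (X x + Y x)) \<partial>M) \<le> (\<integral>\<^sup>+x. ennreal (u (X' x + Y' x)) \<partial>M)"
proof -
  note [measurable] = convex_real_measurable[OF u]
  have N: "0 \<le> N" using boundX(1)[of undefined] by simp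
  define p where "p m k = real k / real (Suc m) - N" for m k
  define n where "n m = nat \<lfloor>real (Suc m) * (2 * N)\<rfloor>" for m
  \<comment> \<open>The cap \<open>n m\<close> bounds the index for every real \<open>y\<close>; for
    \<open>\<bar>y\<bar> \<le> N\<close> it is inactive.\<close>
  define K where "K m y = min (n m) (nat \<lfloor>real (Suc m) * (y + N)\<rfloor>)" for m y
  have [measurable]: "K m \<in> measurable borel (count_space UNIV)" for m
    unfolding K_def by measurable
  have Kn: "K m y \<le> n m" for m y by (simp add: K_def)
  have monoK: "mono (K m)" for m
    unfolding K_def by (intro monoI min.mono order_refl nat_mono floor_mono mult_left_mono) auto
  have monop: "mono (p m)" for m
    unfolding p_def by (intro monoI diff_right_mono divide_right_mono) auto
  have near: "y - inverse (real (Suc m)) \<le> p m (K m y)" "p m (K m y) \<le> y" if "\<bar>y\<bar> \<le> N" for m y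
  proof -
    have y: "0 \<le> y + N" "y + N \<le> 2 * N" using that by auto
    have "\<lfloor>real (Suc m) * (y + N)\<rfloor> \<le> \<lfloor>real (Suc m) * (2 * N)\<rfloor>"
      using y by (intro floor_mono mult_left_mono) auto
    then have "K m y = nat \<lfloor>real (Suc m) * (y + N)\<rfloor>"
      unfolding K_def n_def by (intro min_absorb2 nat_mono)
    moreover have "0 \<le> real (Suc m) * (y + N)" using y by simp
    ultimately have "real (K m y) = of_int \<lfloor>real (Suc m) * (y + N)\<rfloor>"
      by (metis of_nat_nat zero_le_floor)
    then have "real (K m y) \<le> real (Suc m) * (y + N)" "real (Suc m) * (y + N) - 1 \<le> real (K m y)"
      by linarith+
    then have "real (K m y) / real (Suc m) \<le> y + N"
        "(real (Suc m) * (y + N) - 1) / real (Suc m) \<le> real (K m y) / real (Suc m)"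
      by (auto simp: pos_divide_le_eq mult.commute intro: divide_right_mono)
    moreover have "(real (Suc m) * (y + N) - 1) / real (Suc m) = y + N - inverse (real (Suc m))"
      by (simp add: diff_divide_distrib inverse_eq_divide)
    ultimately show "y - inverse (real (Suc m)) \<le> p m (K m y)" "p m (K m y) \<le> y"
      unfolding p_def by linarith+
  qed
  have lim_p: "(\<lambda>m. p m (K m y)) \<longlonglongrightarrow> y" if "\<bar>y\<bar> \<le> N" for y
  proof (rule tendsto_sandwich)
    show "(\<lambda>m. y - inverse (real (Suc m))) \<longlonglongrightarrow> y"
      using tendsto_diff[OF tendsto_const[of y] LIMSEQ_inverse_real_of_nat] by simp
  qed (use near[OF that] in auto)
  \<comment> \<open>The extra 1 below leaves room for the rounding error, which is at most
    1/(m+1).\<close>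
  have "bounded (u ` {- 2 * N - 1..2 * N})"
    by (intro compact_imp_bounded compact_continuous_image
        continuous_on_subset[OF convex_real_continuous[OF u]]) auto
  then obtain B where B: "\<And>s. - 2 * N - 1 \<le> s \<Longrightarrow> s \<le> 2 * N \<Longrightarrow> \<bar>u s\<bar> \<le> B"
    unfolding bounded_iff by (metis imageI real_norm_def atLeastAtMost_iff)
  have lim: "(\<lambda>m. \<integral>x. u (p m (K m (V x)) + Z x) \<partial>M) \<longlonglongrightarrow> (\<integral>x. u (V x + Z x) \<partial>M)"
    if [measurable]: "V \<in> borel_measurable M" "Z \<in> borel_measurable M"
      and V: "\<And>x. \<bar>V x\<bar> \<le> N" and Z: "\<And>x. \<bar>Z x\<bar> \<le> N" for V Z :: "'a \<Rightarrow> real"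
  proof (rule integral_dominated_convergence[where w = "\<lambda>_. B"])
    show "AE x in M. (\<lambda>m. u (p m (K m (V x)) + Z x)) \<longlonglongrightarrow> u (V x + Z x)"
    proof (rule AE_I2)
      fix x
      have "isCont u (V x + Z x)"
        using convex_real_continuous[OF u] by (simp add: continuous_on_eq_continuous_at)
      then show "(\<lambda>m. u (p m (K m (V x)) + Z x)) \<longlonglongrightarrow> u (V x + Z x)"
        by (rule isCont_tendsto_compose) (intro tendsto_add lim_p V tendsto_const)
    qed
    show "AE x in M. norm (u (p m (K m (V x)) + Z x)) \<le> B" for m
    proof (rule AE_I2)
      fix x
      have "inverse (real (Suc m)) \<le> 1" by (simp add: divide_simps)
      then show "norm (u (p m (K m (V x)) + Z x)) \<le> B"
        using near[OF V[of x], of m] V[of x] Z[of x] unfolding real_norm_def by (intro B) linarith+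
    qed
  qed auto
  have int: "(\<integral>\<^sup>+x. ennreal (u (V x + Z x)) \<partial>M) = ennreal (\<integral>x. u (V x + Z x) \<partial>M)"
    if [measurable]: "V \<in> borel_measurable M" "Z \<in> borel_measurable M"
      and V: "\<And>x. \<bar>V x\<bar> \<le> N" and Z: "\<And>x. \<bar>Z x\<bar> \<le> N" for V Z :: "'a \<Rightarrow> real"
  proof (rule nn_integral_eq_integral)
    have "\<bar>u (V x + Z x)\<bar> \<le> B" for x
      using V[of x] Z[of x] N by (intro B) linarith+
    then show "integrable M (\<lambda>x. u (V x + Z x))"
      by (intro integrable_const_bound[of _ B]) auto
  qed (use u0 in auto)
  have "(\<integral>x. u (X x + Y x) \<partial>M) \<le> (\<integral>x. u (X' x + Y' x) \<partial>M)"
  proof (rule LIMSEQ_le[OF lim lim])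
    show "\<exists>k. \<forall>m\<ge>k. (\<integral>x. u (p m (K m (X x)) + Y x) \<partial>M) \<le> (\<integral>x. u (p m (K m (X' x)) + Y' x) \<partial>M)"
      by (intro exI allI impI opposed_grid_le[OF assms(1-4) _ DX DY S boundY monoK Kn monop u]) measurable
  qed (use boundX boundY in auto)
  then show ?thesis
    using boundX boundY by (simp add: int ennreal_leI)
qed

text \<open>Clipping both variables moves their sum towards the minimizer 0 and so lowers
  \<open>u\<close>. Hence the clipped left sides are all bounded by the unclipped right side, and
  Fatou's lemma removes the clipping on the left.\<close>

lemma (in prob_space) opposed_pair_le_min0:
  fixes X X' Y Y' :: "'a \<Rightarrow> real"
  assumes [measurable]: "X \<in> borel_measurable M" "X' \<in> borel_measurable M"
      "Y \<in> borel_measurable M" "Y' \<in> borel_measurable M"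
    and DX: "distr M borel X = distr M borel X'" and DY: "distr M borel Y = distr M borel Y'"
    and S: "AE x in M. x \<in> S" "opposed_on S X Y"
    and u: "convex_on UNIV u" and u0: "\<And>s. 0 \<le> u s" "u 0 = 0"
  shows "(\<integral>\<^sup>+x. ennreal (u (X x + Y x)) \<partial>M) \<le> (\<integral>\<^sup>+x. ennreal (u (X' x + Y' x)) \<partial>M)"
proof -
  note [measurable] = convex_real_measurable[OF u]
  have clip_le: "u (clip (real n) a + clip (real n) b) \<le> u (a + b)" for n a b
  proof -
    \<comment> \<open>Oddness turns the sum of the clipped values into a difference for
      \<open>clip_diff_scaled\<close>.\<close>
    have "clip (real n) (- b) = - clip (real n) b" by (auto simp: clip_def)
    then obtain t where "0 \<le> t" "t \<le> 1" "clip (real n) a + clip (real n) b = t * (a + b)"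
      using clip_diff_scaled[of "real n" a "- b"] by auto
    then show ?thesis using convex_min_at_0_le[OF u u0(2,1)] by simp
  qed
  have clipped: "(\<integral>\<^sup>+x. ennreal (u (clip (real n) (X x) + clip (real n) (Y x))) \<partial>M)
      \<le> (\<integral>\<^sup>+x. ennreal (u (X' x + Y' x)) \<partial>M)" for n
  proof -
    have opp: "opposed_on S (\<lambda>x. clip (real n) (X x)) (\<lambda>x. clip (real n) (Y x))"
      using S(2) unfolding opposed_on_def by (meson clip_mono not_less)
    have dX: "distr M borel (\<lambda>x. clip (real n) (X x)) = distr M borel (\<lambda>x. clip (real n) (X' x))"
      by (rule distr_eq_compose[OF _ _ _ DX]) auto
    have dY: "distr M borel (\<lambda>x. clip (real n) (Y x)) = distr M borel (\<lambda>x. clip (real n) (Y' x))"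
      by (rule distr_eq_compose[OF _ _ _ DY]) auto
    have "(\<integral>\<^sup>+x. ennreal (u (clip (real n) (X x) + clip (real n) (Y x))) \<partial>M)
        \<le> (\<integral>\<^sup>+x. ennreal (u (clip (real n) (X' x) + clip (real n) (Y' x))) \<partial>M)"
      by (rule opposed_bounded_le[OF _ _ _ _ dX dY S(1) opp _ _ _ _ u u0(1), of "real n"])
        (auto intro: abs_clip_le)
    also have "\<dots> \<le> (\<integral>\<^sup>+x. ennreal (u (X' x + Y' x)) \<partial>M)"
      by (intro nn_integral_mono ennreal_leI clip_le)
    finally show ?thesis .
  qed
  have lim: "liminf (\<lambda>n. ennreal (u (clip (real n) a + clip (real n) b))) = ennreal (u (a + b))" for a b
  proof (rule lim_imp_Liminf[OF sequentially_bot tendsto_eventually])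
    show "eventually (\<lambda>n. ennreal (u (clip (real n) a + clip (real n) b)) = ennreal (u (a + b))) sequentially"
      using clip_eventually[of a] clip_eventually[of b] by eventually_elim simp
  qed
  have "(\<integral>\<^sup>+x. ennreal (u (X x + Y x)) \<partial>M)
      = (\<integral>\<^sup>+x. liminf (\<lambda>n. ennreal (u (clip (real n) (X x) + clip (real n) (Y x)))) \<partial>M)"
    by (simp add: lim)
  also have "\<dots> \<le> liminf (\<lambda>n. \<integral>\<^sup>+x. ennreal (u (clip (real n) (X x) + clip (real n) (Y x))) \<partial>M)"
    by (rule nn_integral_liminf) measurable
  also have "\<dots> \<le> limsup (\<lambda>n. \<integral>\<^sup>+x. ennreal (u (clip (real n) (X x) + clip (real n) (Y x))) \<partial>M)"
    by (rule Liminf_le_Limsup) simp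
  also have "\<dots> \<le> (\<integral>\<^sup>+x. ennreal (u (X' x + Y' x)) \<partial>M)"
    by (rule Limsup_bounded) (simp add: clipped)
  finally show ?thesis .
qed

lemma (in prob_space) opposed_pair_le:
  fixes X X' Y Y' :: "'a \<Rightarrow> real"
  assumes [measurable]: "X \<in> borel_measurable M" "X' \<in> borel_measurable M"
      "Y \<in> borel_measurable M" "Y' \<in> borel_measurable M"
    and DX: "distr M borel X = distr M borel X'" and DY: "distr M borel Y = distr M borel Y'"
    and S: "AE x in M. x \<in> S" "opposed_on S X Y"
    and u: "convex_on UNIV u" and u0: "\<And>s. 0 \<le> u s"
  shows "(\<integral>\<^sup>+x. ennreal (u (X x + Y x)) \<partial>M) \<le> (\<integral>\<^sup>+x. ennreal (u (X' x + Y' x)) \<partial>M)"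
proof (rule ennreal_le_epsilon)
  note [measurable] = convex_real_measurable[OF u]
  fix e :: real assume e: "0 < e"
  have bdd: "bdd_below (range u)" using u0 by (intro bdd_belowI[of _ 0]) auto
  text \<open>The infimum of \<open>u\<close> need not be attained; truncating \<open>u\<close> from below at a value \<open>u s\<close>
    within \<open>e\<close> of the infimum makes \<open>s\<close> a minimizer.\<close>
  obtain s where s: "u s < Inf (range u) + e"
    using cInf_lessD[of "range u" "Inf (range u) + e"] e by auto
  have le: "max (u y) (u s) \<le> u y + e" for y
    using s cInf_lower[OF rangeI bdd, of y] e by auto
  \<comment> \<open>\<open>w\<close> has minimum 0 at 0, and \<open>w (y - s) + u s\<close> lies
    between \<open>u y\<close> and \<open>u y + e\<close>.\<close>
  define w where "w y = max (u (y + s)) (u s) + (- u s)" for y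
  have w: "convex_on UNIV w"
    unfolding w_def by (intro convex_on_max_add convex_on_compose_add u)
  have w0: "0 \<le> w y" "w 0 = 0" for y by (auto simp: w_def)
  have [measurable]: "w \<in> borel_measurable borel" by (rule convex_real_measurable[OF w])
  have shift: "opposed_on S (\<lambda>x. X x + - s) Y"
    using S(2) by (simp add: opposed_on_def)
  have "(\<integral>\<^sup>+x. ennreal (u (X x + Y x)) \<partial>M) \<le> (\<integral>\<^sup>+x. ennreal (w ((X x + - s) + Y x)) + ennreal (u s) \<partial>M)"
    using w0(1) u0 by (intro nn_integral_mono)
      (auto simp: w_def ennreal_plus[symmetric] simp del: ennreal_plus intro!: ennreal_leI)
  also have "\<dots> = (\<integral>\<^sup>+x. ennreal (w ((X x + - s) + Y x)) \<partial>M) + ennreal (u s)"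
    by (subst nn_integral_add) (auto simp: emeasure_space_1)
  also have "\<dots> \<le> (\<integral>\<^sup>+x. ennreal (w ((X' x + - s) + Y' x)) \<partial>M) + ennreal (u s)"
    by (intro add_right_mono opposed_pair_le_min0[OF _ _ _ _ _ DY S(1) shift w w0]
        distr_eq_compose[where h = "\<lambda>y. y + - s", OF _ _ _ DX]) auto
  also have "\<dots> = (\<integral>\<^sup>+x. ennreal (w ((X' x + - s) + Y' x)) + ennreal (u s) \<partial>M)"
    by (subst nn_integral_add) (auto simp: emeasure_space_1)
  also have "\<dots> \<le> (\<integral>\<^sup>+x. ennreal (u (X' x + Y' x)) + ennreal e \<partial>M)"
    using w0(1) u0 e le by (intro nn_integral_mono)
      (auto simp: w_def ennreal_plus[symmetric] simp del: ennreal_plus intro!: ennreal_leI)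
  also have "\<dots> = (\<integral>\<^sup>+x. ennreal (u (X' x + Y' x)) \<partial>M) + ennreal e"
    by (subst nn_integral_add) (auto simp: emeasure_space_1)
  finally show "(\<integral>\<^sup>+x. ennreal (u (X x + Y x)) \<partial>M) \<le> (\<integral>\<^sup>+x. ennreal (u (X' x + Y' x)) \<partial>M) + ennreal e" .
qed

section \<open>Structure of pairwise opposed families\<close>

definition opposed_family :: "'a set \<Rightarrow> nat \<Rightarrow> (nat \<Rightarrow> 'a \<Rightarrow> real) \<Rightarrow> bool" where
  "opposed_family S d X \<longleftrightarrow> (\<forall>i<d. \<forall>j<d. i \<noteq> j \<longrightarrow> opposed_on S (X i) (X j))"

lemma opposed_familyD:
  "opposed_family S d X \<Longrightarrow> i < d \<Longrightarrow> j < d \<Longrightarrow> i \<noteq> j \<Longrightarrow> x \<in> S \<Longrightarrow> y \<in> S \<Longrightarrow>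
    X i x < X i y \<Longrightarrow> X j y \<le> X j x"
  by (auto simp: opposed_family_def opposed_on_def)

lemma opposed_family_uminus:
  "opposed_family S d X \<Longrightarrow> opposed_family S d (\<lambda>i x. - X i x)"
  by (auto simp: opposed_family_def opposed_on_def)

text \<open>Each pair has its own latent variable and its own set of full measure; intersecting
  these finitely many sets gives one \<open>S\<close> for all pairs.\<close>

lemma counter_monotonic_vec_imp_opposed_family:
  assumes "counter_monotonic_vec M d X"
  shows "\<exists>S. (AE x in M. x \<in> S) \<and> opposed_family S d X"
proof -
  have "\<exists>S. (AE x in M. x \<in> S) \<and> opposed_on S (X i) (X j)" if "i < d" "j < d" "i \<noteq> j" for i j
    using assms that counter_monotonic_imp_opposed_on[of M "X i" "X j"]
    by (auto simp: counter_monotonic_vec_def)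
  then obtain T where T: "\<And>i j. i < d \<Longrightarrow> j < d \<Longrightarrow> i \<noteq> j \<Longrightarrow>
      (AE x in M. x \<in> T i j) \<and> opposed_on (T i j) (X i) (X j)"
    by metis
  define S where "S = {x. \<forall>i\<in>{..<d}. \<forall>j\<in>{..<d}. i \<noteq> j \<longrightarrow> x \<in> T i j}"
  have "AE x in M. i \<noteq> j \<longrightarrow> x \<in> T i j" if "i \<in> {..<d}" "j \<in> {..<d}" for i j
    using T[of i j] that by (cases "i = j") auto
  then have "AE x in M. \<forall>i\<in>{..<d}. \<forall>j\<in>{..<d}. i \<noteq> j \<longrightarrow> x \<in> T i j"
    by (intro AE_finite_allI) auto
  then have "AE x in M. x \<in> S" by (rule eventually_mono) (simp add: S_def)
  moreover have "opposed_family S d X"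
    using T unfolding opposed_family_def opposed_on_def S_def by force
  ultimately show ?thesis by blast
qed

text \<open>Geometrically, each sample vector lies on a ray from \<open>m\<close> in a positive
  coordinate direction.\<close>

definition centred_on :: "'a set \<Rightarrow> nat \<Rightarrow> (nat \<Rightarrow> 'a \<Rightarrow> real) \<Rightarrow> (nat \<Rightarrow> real) \<Rightarrow> bool" where
  "centred_on S d X m \<longleftrightarrow> (\<forall>x\<in>S. (\<forall>i<d. m i \<le> X i x) \<and>
      (\<forall>i<d. \<forall>j<d. i \<noteq> j \<longrightarrow> X i x = m i \<or> X j x = m j))"

text \<open>Three points on different rays from \<open>m\<close> force every other point onto such a ray.\<close>

lemma opposed_family_centred_on:
  assumes opp: "opposed_family S d X" and R: "R \<subseteq> {..<d}" "card R = 3"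
    and v: "\<And>r. r \<in> R \<Longrightarrow> v r \<in> S"
      "\<And>r. r \<in> R \<Longrightarrow> m r < X r (v r)"
      "\<And>r l. r \<in> R \<Longrightarrow> l < d \<Longrightarrow> l \<noteq> r \<Longrightarrow> X l (v r) = m l"
  shows "centred_on S d X m"
  unfolding centred_on_def
proof (intro ballI conjI allI impI)
  have avoid: "\<exists>r\<in>R. r \<noteq> p \<and> r \<noteq> q" for p q
  proof (rule ccontr)
    assume "\<not> ?thesis"
    then have "card R \<le> card {p, q}" by (intro card_mono) auto
    also have "\<dots> \<le> 2" by (simp add: card_insert_if)
    finally show False using R by simp
  qed
  fix x assume x: "x \<in> S"
  show "m l \<le> X l x" if l: "l < d" for l
  proof (rule ccontr)
    assume less: "\<not> m l \<le> X l x"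
    have up: "m r < X r x" if r: "r \<in> R" "r \<noteq> l" for r
    proof -
      have "X l x < X l (v r)" using less v(3)[of r l] r l by auto
      then have "X r (v r) \<le> X r x"
        using opposed_familyD[OF opp l _ _ x v(1)[OF r(1)], of r] R r by auto
      then show ?thesis using v(2)[OF r(1)] by simp
    qed
    obtain i where i: "i \<in> R" "i \<noteq> l" using avoid[of l l] by auto
    obtain j where j: "j \<in> R" "j \<noteq> l" "j \<noteq> i" using avoid[of l i] by auto
    have "X j (v i) = m j" using v(3)[OF i(1), of j] j R by auto
    then have "X j (v i) < X j x" using up j by simp
    obtain k where k: "k \<in> R" "k \<noteq> i" "k \<noteq> j" using avoid[of i j] by auto
    \<comment> \<open>Two coordinates may not both rise between two points. If \<open>l\<close> is
      outside \<open>R\<close>, then \<open>j\<close> and \<open>k\<close> rise from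
      \<open>v i\<close> to \<open>x\<close>; otherwise \<open>k = l\<close>, and \<open>i\<close>
      and \<open>j\<close> rise from \<open>v l\<close> to \<open>x\<close>.\<close>
    show False
    proof (cases "k = l")
      case False
      have "X k (v i) = m k" using v(3)[OF i(1), of k] k R by auto
      then have "X k (v i) < X k x" using up k False by simp
      then show False
        using opposed_familyD[OF opp _ _ _ v(1)[OF i(1)] x, of k j] R k j
          \<open>X j (v i) < X j x\<close> by auto
    next
      case True
      have "l \<in> R" using True k by simp
      have "X i (v l) < X i x" "X j (v l) < X j x"
        using v(3)[OF \<open>l \<in> R\<close>, of i] v(3)[OF \<open>l \<in> R\<close>, of j] up i j R by auto
      then show False
        using opposed_familyD[OF opp _ _ _ v(1)[OF \<open>l \<in> R\<close>] x, of i j] R i j by auto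
    qed
  qed
  note lower = this
  fix p q assume pq: "p < d" "q < d" "p \<noteq> q"
  show "X p x = m p \<or> X q x = m q"
  proof (rule ccontr)
    assume "\<not> ?thesis"
    then have gt: "m p < X p x" "m q < X q x" using lower[OF pq(1)] lower[OF pq(2)] by auto
    \<comment> \<open>On a ray avoiding both directions, \<open>v r\<close> has coordinates
      \<open>m p\<close> and \<open>m q\<close>, so both would rise from \<open>v r\<close> to
      \<open>x\<close>.\<close>
    obtain r where r: "r \<in> R" "r \<noteq> p" "r \<noteq> q" using avoid[of p q] by auto
    then have "X p (v r) < X p x" "X q (v r) < X q x"
      using v(3)[OF r(1), of p] v(3)[OF r(1), of q] pq gt by auto
    then show False
      using opposed_familyD[OF opp _ _ _ v(1)[OF r(1)] x, of p q] pq by auto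
  qed
qed

text \<open>The centre takes coordinate \<open>i\<close> from \<open>v\<close>, \<open>j\<close>
  from \<open>v'\<close> and \<open>k\<close> from \<open>v\<close>. Opposedness forces all
  remaining coordinates to agree, so \<open>v'\<close>, \<open>v\<close> and \<open>v''\<close> lie
  on the rays of \<open>i\<close>, \<open>j\<close> and \<open>k\<close> respectively.\<close>

lemma opposed_family_two_rays:
  assumes opp: "opposed_family S d X"
    and d: "i < d" "j < d" "k < d" "i \<noteq> j" "i \<noteq> k" "j \<noteq> k"
    and S: "v \<in> S" "v' \<in> S" "v'' \<in> S"
    and less: "X i v < X i v'" "X j v' < X j v" "X k v < X k v''"
  shows "\<exists>m. centred_on S d X m"
proof -
  note D = opposed_familyD[OF opp]
  \<comment> \<open>Going from \<open>v\<close> to \<open>v'\<close>, \<open>i\<close> rises, so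
    \<open>l\<close> cannot; going back, \<open>j\<close> rises, so again \<open>l\<close>
    cannot.\<close>
  have same: "X l v' = X l v" if l: "l < d" "l \<noteq> i" "l \<noteq> j" for l
    using D[OF d(1) l(1) _ S(1,2) less(1)] D[OF d(2) l(1) _ S(2,1) less(2)] l by auto
  have less': "X k v' < X k v''" using same[of k] d less by simp
  have i'': "X i v'' \<le> X i v" using D[OF d(3,1) _ S(1,3) less(3)] d by simp
  have j'': "X j v'' \<le> X j v'" using D[OF d(3,2) _ S(2,3) less'] d by simp
  have "X j v' \<le> X j v''" using D[OF d(1,2,4) S(3,2)] i'' less by simp
  then have j: "X j v'' = X j v'" using j'' by simp
  then have "X i v \<le> X i v''" using D[OF d(2,1) _ S(3,1)] d less by simp
  then have i: "X i v'' = X i v" using i'' by simp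
  have other: "X l v'' = X l v" if l: "l < d" "l \<noteq> i" "l \<noteq> j" "l \<noteq> k" for l
    using D[OF d(3) l(1) _ S(1,3) less(3)] D[OF d(1) l(1) _ S(3,2)] same[of l] i less l by force
  define m where "m l = (if l = k then X k v else X l v'')" for l
  define w where "w l = (if l = i then v' else if l = j then v else v'')" for l
  have "centred_on S d X m"
  proof (rule opposed_family_centred_on[OF opp])
    show "{i, j, k} \<subseteq> {..<d}" "card {i, j, k} = 3" using d by auto
    show "w r \<in> S" "m r < X r (w r)" if "r \<in> {i, j, k}" for r
      using that d S less i j by (auto simp: w_def m_def)
    show "X l (w r) = m l" if "r \<in> {i, j, k}" "l < d" "l \<noteq> r" for r l
      using that d i j other[of l] same[of l]
      by (cases "l = i"; cases "l = j"; cases "l = k") (auto simp: w_def m_def)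
  qed
  then show ?thesis by blast
qed

lemma opposed_family_cases:
  assumes opp: "opposed_family S d X" and "2 \<le> d"
  obtains
    (pair) i j where "i < d" "j < d" "i \<noteq> j"
      "\<And>l. l < d \<Longrightarrow> l \<noteq> i \<Longrightarrow> l \<noteq> j \<Longrightarrow> \<exists>c. \<forall>x\<in>S. X l x = c"
  | (lower) m where "centred_on S d X m"
  | (upper) m where "centred_on S d (\<lambda>i x. - X i x) m"
proof -
  define C where "C = {i. i < d \<and> (\<exists>x\<in>S. \<exists>y\<in>S. X i x < X i y)}"
  have C: "C \<subseteq> {..<d}" by (auto simp: C_def)
  then have fin: "finite C" by (rule finite_subset) simp
  show ?thesis
  proof (cases "card C \<le> 2")
    case True
    \<comment> \<open>The set of nonconstant components is padded to exactly two indices, which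
      \<open>2 \<le> d\<close> permits.\<close>
    then obtain T where T: "C \<subseteq> T" "T \<subseteq> {..<d}" "card T = 2"
      using exists_subset_between[of C 2 "{..<d}"] C \<open>2 \<le> d\<close> by auto
    then obtain i j where ij: "T = {i, j}" "i \<noteq> j" by (auto simp: card_2_iff)
    show ?thesis
    proof (rule pair)
      fix l assume "l < d" "l \<noteq> i" "l \<noteq> j"
      then have "l \<notin> C" using T ij by auto
      then have "X l x = X l y" if "x \<in> S" "y \<in> S" for x y
        using that \<open>l < d\<close> unfolding C_def by (metis (mono_tags, lifting) linorder_neqE mem_Collect_eq)
      then show "\<exists>c. \<forall>x\<in>S. X l x = c" by metis
    qed (use T ij in auto)
  next
    case False
    then obtain T where "T \<subseteq> C" "card T = 3"
      using obtain_subset_with_card_n[of 3 C] by (metis not_less_eq_eq numeral_2_eq_2 numeral_3_eq_3)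
    moreover obtain i j k where "T = {i, j, k}" "i \<noteq> j" "i \<noteq> k" "j \<noteq> k"
      using \<open>card T = 3\<close> unfolding card_3_iff by blast
    ultimately have ijk: "i \<in> C" "j \<in> C" "k \<in> C" "i \<noteq> j" "i \<noteq> k" "j \<noteq> k"
      by auto
    have d: "i < d" "j < d" "k < d" using ijk by (auto simp: C_def)
    note D = opposed_familyD[OF opp]
    obtain x y where xy: "x \<in> S" "y \<in> S" "X i x < X i y" using ijk by (auto simp: C_def)
    obtain z w where zw: "z \<in> S" "w \<in> S" "X j z < X j w" using ijk by (auto simp: C_def)
    \<comment> \<open>Points differing in both coordinates must differ in opposite directions;
      \<open>v\<close> is the one with the smaller \<open>i\<close>-coordinate.\<close>
    have both: "\<exists>v\<in>S. \<exists>v'\<in>S. X i v < X i v' \<and> X j v' < X j v"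
      if "e \<in> S" "f \<in> S" "X i e \<noteq> X i f" "X j e \<noteq> X j f" for e f
      using that D[OF d(1,2) ijk(4), of e f] D[OF d(1,2) ijk(4), of f e]
      by (metis linorder_neqE order_le_less)
    have "\<exists>v\<in>S. \<exists>v'\<in>S. X i v < X i v' \<and> X j v' < X j v"
    proof (cases "X j x \<noteq> X j y \<or> X i z \<noteq> X i w")
      case True
      then show ?thesis using both[of x y] both[of z w] xy zw by auto
    next
      case False
      \<comment> \<open>Now \<open>j\<close> is constant on \<open>{x, y}\<close> and
        \<open>i\<close> on \<open>{z, w}\<close>, so a mixed pair \<open>e\<close>,
        \<open>f\<close> can be chosen to differ in both coordinates.\<close>
      obtain e where "e \<in> {x, y}" "X i e \<noteq> X i z"
        using xy(3) by (metis insertI1 insertI2 less_irrefl)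
      moreover obtain f where "f \<in> {z, w}" "X j f \<noteq> X j x"
        using zw(3) by (metis insertI1 insertI2 less_irrefl)
      ultimately show ?thesis using both[of e f] False xy zw by auto
    qed
    then obtain v v' where v: "v \<in> S" "v' \<in> S" "X i v < X i v'" "X j v' < X j v" by auto
    obtain a b where "a \<in> S" "b \<in> S" "X k a < X k b" using ijk by (auto simp: C_def)
    then obtain v'' where v'': "v'' \<in> S" "X k v'' \<noteq> X k v" by (metis less_irrefl)
    show ?thesis
    proof (cases "X k v < X k v''")
      case True
      then show ?thesis
        using opposed_family_two_rays[OF opp d ijk(4,5,6) v(1,2) v''(1) v(3,4)] lower by blast
    next
      case False
      \<comment> \<open>Here \<open>k\<close> falls from \<open>v\<close> to \<open>v''\<close>.
        Negation makes it rise and exchanges the roles of \<open>i\<close> and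
        \<open>j\<close>.\<close>
      then have "\<exists>m. centred_on S d (\<lambda>i x. - X i x) m"
        using d ijk v v''
        by (intro opposed_family_two_rays[OF opposed_family_uminus[OF opp], of j i k v v' v'']) auto
      then show ?thesis using upper by blast
    qed
  qed
qed

section \<open>Sums of pairwise opposed families\<close>

lemma (in prob_space) opposed_family_sum_le:
  fixes X Y :: "nat \<Rightarrow> 'a \<Rightarrow> real"
  assumes X [measurable]: "\<And>i. i < d \<Longrightarrow> X i \<in> borel_measurable M"
    and Y [measurable]: "\<And>i. i < d \<Longrightarrow> Y i \<in> borel_measurable M"
    and D: "\<And>i. i < d \<Longrightarrow> distr M borel (Y i) = distr M borel (X i)"
    and S: "AE x in M. x \<in> S" and opp: "opposed_family S d Y"
    and u: "convex_on UNIV u" and u0: "\<And>s. 0 \<le> u s"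
  shows "(\<integral>\<^sup>+x. ennreal (u (\<Sum>i<d. Y i x)) \<partial>M) \<le> (\<integral>\<^sup>+x. ennreal (u (\<Sum>i<d. X i x)) \<partial>M)"
proof (cases "2 \<le> d")
  case False
  note [measurable] = convex_real_measurable[OF u]
  from False consider "d = 0" | "d = Suc 0" by linarith
  then show ?thesis
  proof cases
    case 2
    then show ?thesis
      using nn_integral_eq_distr[OF Y X _ D, of 0 "\<lambda>y. ennreal (u y)"] by simp
  qed simp
next
  case True
  note [measurable] = convex_real_measurable[OF u]
  from opp True show ?thesis
  proof (cases rule: opposed_family_cases)
    case (pair i j)
    define I where "I = {..<d} - {i, j}"
    have "\<exists>c. \<forall>x\<in>S. Y l x = c" if "l \<in> I" for l
      using pair(4)[of l] that by (auto simp: I_def)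
    then obtain c where c: "\<And>l x. l \<in> I \<Longrightarrow> x \<in> S \<Longrightarrow> Y l x = c l" by metis
    have Yc: "AE x in M. Y l x = c l" if "l \<in> I" for l
      using S by eventually_elim (use c that in auto)
    \<comment> \<open>Almost sure constancy depends only on the marginal law, so both sums contain
      the same constant, which a translation of \<open>u\<close> absorbs.\<close>
    have Xc: "AE x in M. X l x = c l" if "l \<in> I" for l
      using AE_eq_distr[OF Y X _ D Yc[OF that]] that by (auto simp: I_def)
    have reduce: "AE x in M. (\<Sum>i<d. Z i x) = Z i x + Z j x + sum c I"
      if "\<And>l. l \<in> I \<Longrightarrow> AE x in M. Z l x = c l" for Z
    proof -
      have "AE x in M. \<forall>l\<in>I. Z l x = c l"
        using that by (intro AE_finite_allI) (auto simp: I_def)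
      then show ?thesis
      proof eventually_elim
        case (elim x)
        have "{..<d} = insert i (insert j I)" using pair by (auto simp: I_def)
        moreover have "finite I" "i \<notin> insert j I" "j \<notin> I" using pair by (auto simp: I_def)
        ultimately have "(\<Sum>i<d. Z i x) = Z i x + (Z j x + (\<Sum>l\<in>I. Z l x))"
          by simp
        then show ?case using elim by simp
      qed
    qed
    have reduceY: "AE x in M. (\<Sum>i<d. Y i x) = Y i x + Y j x + sum c I" by (rule reduce[OF Yc])
    have reduceX: "AE x in M. (\<Sum>i<d. X i x) = X i x + X j x + sum c I" by (rule reduce[OF Xc])
    have "(\<integral>\<^sup>+x. ennreal (u (\<Sum>i<d. Y i x)) \<partial>M) = (\<integral>\<^sup>+x. ennreal (u (Y i x + Y j x + sum c I)) \<partial>M)"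
      by (rule nn_integral_cong_AE) (use reduceY in \<open>eventually_elim, simp\<close>)
    also have "\<dots> \<le> (\<integral>\<^sup>+x. ennreal (u (X i x + X j x + sum c I)) \<partial>M)"
      using pair opp
      by (intro opposed_pair_le[OF Y X Y X D D S _ convex_on_compose_add[OF u] u0])
        (auto simp: opposed_family_def)
    also have "\<dots> = (\<integral>\<^sup>+x. ennreal (u (\<Sum>i<d. X i x)) \<partial>M)"
      by (rule nn_integral_cong_AE) (use reduceX in \<open>eventually_elim, simp\<close>)
    finally show ?thesis .
  next
    case (lower m)
    have "AE x in M. \<forall>i<d. m i \<le> Y i x"
      "AE x in M. \<forall>i<d. \<forall>j<d. i \<noteq> j \<longrightarrow> Y i x = m i \<or> Y j x = m j"
      using S by (eventually_elim, use lower in \<open>auto simp: centred_on_def\<close>)+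
    then show ?thesis by (intro exclusive_sum_le[OF X Y D _ _ u u0])
  next
    case (upper m)
    have "AE x in M. \<forall>i<d. m i \<le> - Y i x"
      "AE x in M. \<forall>i<d. \<forall>j<d. i \<noteq> j \<longrightarrow> - Y i x = m i \<or> - Y j x = m j"
      using S by (eventually_elim, use upper in \<open>auto simp: centred_on_def\<close>)+
    \<comment> \<open>Reflection: the lower case is applied to the negated variables and the convex
      function \<open>\<lambda>x. u (- x)\<close>.\<close>
    then have "(\<integral>\<^sup>+x. ennreal (u (- (\<Sum>i<d. - Y i x))) \<partial>M) \<le> (\<integral>\<^sup>+x. ennreal (u (- (\<Sum>i<d. - X i x))) \<partial>M)"
      using distr_eq_compose[OF Y X borel_measurable_uminus[OF measurable_ident] D]
      by (intro exclusive_sum_le[where Y = "\<lambda>i x. - Y i x" and X = "\<lambda>i x. - X i x" and m = m,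
            OF _ _ _ _ _ convex_on_compose_uminus[OF u] u0]) simp_all
    then show ?thesis by (simp add: sum_negf)
  qed
qed

theorem theorem6:
  fixes M :: "'a measure" and d :: nat
    and X Xct :: "nat \<Rightarrow> 'a \<Rightarrow> real"
  assumes "prob_space M"
    and "atomless M"
    and "\<forall>i<d. X i \<in> borel_measurable M"
    and "\<forall>i<d. Xct i \<in> borel_measurable M"
    and "\<forall>i<d. distr M borel (Xct i) = distr M borel (X i)"
    and "counter_monotonic_vec M d Xct"
  shows "cx_le M (\<lambda>\<omega>. \<Sum>i<d. Xct i \<omega>) (\<lambda>\<omega>. \<Sum>i<d. X i \<omega>)"
proof -
  interpret prob_space M by fact
  obtain S where S: "AE x in M. x \<in> S" "opposed_family S d Xct"
    using counter_monotonic_vec_imp_opposed_family[OF assms(6)] by auto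
  show ?thesis
    using assms S by (intro cx_leI opposed_family_sum_le borel_measurable_sum) auto
qed

end
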